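(* In the linear-quadratic network game with endogenous links described in the context, let $(\boldsymbol{\beta}^*,\boldsymbol{\sigma}^* )$ be an optimal subsidy such that (1) the equilibrium selection $(\boldsymbol{\beta},\boldsymbol{\sigma})\mapsto(\boldsymbol{a}^*(\boldsymbol{\beta},\boldsymbol{\sigma}),\boldsymbol{g}^*(\boldsymbol{\beta},\boldsymbol{\sigma}))$ is differentiable in a neighborhood of $(\boldsymbol{\beta}^*,\boldsymbol{\sigma}^* )$, and (2) the planner's budget constraint strictly binds at $(\boldsymbol{\beta}^*,\boldsymbol{\sigma}^* )$. Consider any pair of agents $i\ne j$ such that $s_{ij}<0$ and such that the selected equilibrium at $(\boldsymbol{\beta}^*,\boldsymbol{\sigma}^* )$ has $g_{ij}^*>0$ and $g_{ji}^*>0$. If $\beta_i^*>0$ and $\beta_j^*>0$, then $\sigma_{ij}^*+\sigma_{ji}^*>0$.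
   Context: **Game.** There are $n$ agents $\mathcal{N}=\{1,\dots,n\}$. Simultaneously, each agent $i$ chooses an action $a_i\ge 0$ and link intensities $g_{ij}\ge 0$ for all $j\in\mathcal{N}\setminus\{i\}$. Link strengths are $G_{ij}=G_{ji}=g_{ij}+g_{ji}$ for $i\ne j$, and $G_{ii}=0$. Parameters: $b_i>0$, $\rho>0$, $s_{ij}=s_{ji}\in\mathbb{R}$, $f_{ij}=f_{ji}>0$. Agent $i$'s utility without subsidies is $$U_i(\boldsymbol{a},\boldsymbol{g})=b_ia_i+\rho\sum_{j\ne i}G_{ij}a_ia_j-\frac{a_i^2}{2}+\sum_{j\neq i}s_{ij}G_{ij}-\sum_{j\ne i}\frac{f_{ij}g_{ij}^2}{2}.$$ **Subsidies.** A subsidy (intervention) is $(\boldsymbol{\beta},\boldsymbol{\sigma})$ with $\beta_i\ge0$ for $i\in\mathcal N$ and $\sigma_{ij}\ge0$ for ordered pairs $i\ne j$ (not necessarily symmetric). Under it agent $i$'s utility is $\mathcal{U}_i=U_i(\boldsymbol a,\boldsymbol g)+\beta_ia_i+\sum_{j\ne i}\sigma_{ij}G_{ij}$, and the planner pays $\mathcal{P}=\sum_i\beta_ia_i+\sum_i\sum_{j\ne i}\sigma_{ij}G_{ij}$. Agents play a pure strategy Nash equilibrium of the game with utilities $\mathcal U_i$. An equilibrium selection $(\boldsymbol{a}^*(\boldsymbol{\beta},\boldsymbol{\sigma}),\boldsymbol{g}^*(\boldsymbol{\beta},\boldsymbol{\sigma}))$ is fixed (it assigns a pure Nash equilibrium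 to each subsidy for which one exists; welfare is set to $-\infty$ where none exists). **Planner.** The objective $\mathcal{W}(\boldsymbol a)$ is differentiable and strictly increasing in each argument; the budget is $\mathcal{B}>0$. A subsidy is optimal if an equilibrium exists under it, $\mathcal{P}\le\mathcal{B}$ at the selected equilibrium, and it maximizes $\mathcal{W}(\boldsymbol{a}^*(\boldsymbol{\beta},\boldsymbol{\sigma}))$ among subsidies satisfying the budget constraint at the selected equilibrium. **Conventions.** Neighborhoods and derivatives in $(\boldsymbol\beta,\boldsymbol\sigma)$ are relative to the set of nonnegative subsidies (one-sided at the boundary). The budget constraint *strictly binds* at $(\boldsymbol{\beta}^*,\boldsymbol{\sigma}^* )$ if $\mathcal P=\mathcal B$ there and the Karush–Kuhn–Tucker first-order conditions hold there with a strictly positive multiplier: there is $\lambda>0$ such that, viewing $\mathcal{L}=\mathcal{W}-\lambda\mathcal{P}$ (evaluated at the selected equilibrium) as a function of $(\boldsymbol\beta,\boldsymbol\sigma)$, at $(\boldsymbol{\beta}^*,\boldsymbol{\sigma}^* )$ one has $\frac{d\mathcal L}{d\beta_k}\le0$ with equality if $\beta_k^*>0$, and $\frac{d\mathcal L}{d\sigma_{kl}}\le0$ with equality if $\sigma_{kl}^*>0$, for all $k$ and all $k\neq l$. *)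

theory Defs
  imports "HOL-Analysis.Analysis"
begin

text \<open>
  Agents are the elements of a finite type. Action profiles are vectors and link intensities are
  matrices; since agents have no links to themselves, diagonals of intensity and subsidy matrices
  are fixed to \<open>0\<close>, so that they carry no spurious degrees of freedom.
\<close>

definition profiles :: "((real ^ 'n::finite) \<times> (real ^ 'n ^ 'n)) set" where
  "profiles = {(a, g). (\<forall>i. a $ i \<ge> 0) \<and> (\<forall>i j. g $ i $ j \<ge> 0) \<and> (\<forall>i. g $ i $ i = 0)}"

definition subsidies :: "((real ^ 'n::finite) \<times> (real ^ 'n ^ 'n)) set" where
  "subsidies = {(\<beta>, \<sigma>). (\<forall>i. \<beta> $ i \<ge> 0) \<and> (\<forall>i j. \<sigma> $ i $ j \<ge> 0) \<and> (\<forall>i. \<sigma> $ i $ i = 0)}"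

definition link_strength :: "real ^ 'n ^ 'n \<Rightarrow> 'n::finite \<Rightarrow> 'n \<Rightarrow> real" where
  "link_strength g i j = (if i = j then 0 else g $ i $ j + g $ j $ i)"

definition base_utility ::
  "('n \<Rightarrow> real) \<Rightarrow> real \<Rightarrow> ('n \<Rightarrow> 'n \<Rightarrow> real) \<Rightarrow> ('n \<Rightarrow> 'n \<Rightarrow> real)
    \<Rightarrow> 'n::finite \<Rightarrow> (real ^ 'n) \<times> (real ^ 'n ^ 'n) \<Rightarrow> real" where
  "base_utility b \<rho> s f i = (\<lambda>(a, g).
     b i * a $ i + \<rho> * (\<Sum>j\<in>UNIV - {i}. link_strength g i j * a $ i * a $ j) - (a $ i)\<^sup>2 / 2
     + (\<Sum>j\<in>UNIV - {i}. s i j * link_strength g i j)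
     - (\<Sum>j\<in>UNIV - {i}. f i j * (g $ i $ j)\<^sup>2 / 2))"

definition utility ::
  "('n \<Rightarrow> real) \<Rightarrow> real \<Rightarrow> ('n \<Rightarrow> 'n \<Rightarrow> real) \<Rightarrow> ('n \<Rightarrow> 'n \<Rightarrow> real)
    \<Rightarrow> (real ^ 'n) \<times> (real ^ 'n ^ 'n)
    \<Rightarrow> 'n::finite \<Rightarrow> (real ^ 'n) \<times> (real ^ 'n ^ 'n) \<Rightarrow> real" where
  "utility b \<rho> s f = (\<lambda>(\<beta>, \<sigma>) i (a, g).
     base_utility b \<rho> s f i (a, g) + \<beta> $ i * a $ i
     + (\<Sum>j\<in>UNIV - {i}. \<sigma> $ i $ j * link_strength g i j))"

definition payment ::
  "(real ^ 'n) \<times> (real ^ 'n ^ 'n) \<Rightarrow> (real ^ 'n) \<times> (real ^ 'n ^ 'n::finite) \<Rightarrow> real" where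
  "payment = (\<lambda>(\<beta>, \<sigma>) (a, g).
     (\<Sum>i\<in>UNIV. \<beta> $ i * a $ i)
     + (\<Sum>i\<in>UNIV. \<Sum>j\<in>UNIV - {i}. \<sigma> $ i $ j * link_strength g i j))"

text \<open>A deviation by agent \<open>i\<close> may change \<open>i\<close>'s action and \<open>i\<close>'s row of link intensities jointly.\<close>

definition deviation ::
  "'n::finite \<Rightarrow> (real ^ 'n) \<times> (real ^ 'n ^ 'n) \<Rightarrow> (real ^ 'n) \<times> (real ^ 'n ^ 'n) \<Rightarrow> bool" where
  "deviation i = (\<lambda>(a, g) (a', g').
     (a', g') \<in> profiles \<and> (\<forall>j. j \<noteq> i \<longrightarrow> a' $ j = a $ j \<and> g' $ j = g $ j))"

definition nash_equilibrium ::
  "('n \<Rightarrow> real) \<Rightarrow> real \<Rightarrow> ('n \<Rightarrow> 'n \<Rightarrow> real) \<Rightarrow> ('n \<Rightarrow> 'n \<Rightarrow> real)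
    \<Rightarrow> (real ^ 'n) \<times> (real ^ 'n ^ 'n)
    \<Rightarrow> (real ^ 'n) \<times> (real ^ 'n ^ 'n::finite) \<Rightarrow> bool" where
  "nash_equilibrium b \<rho> s f x p \<longleftrightarrow>
     p \<in> profiles \<and>
     (\<forall>i p'. deviation i p p' \<longrightarrow> utility b \<rho> s f x i p' \<le> utility b \<rho> s f x i p)"

text \<open>
  A selection is a total function whose values are unconstrained at subsidies without an
  equilibrium; every notion below that evaluates it there guards against this.
\<close>

definition equilibrium_selection ::
  "('n \<Rightarrow> real) \<Rightarrow> real \<Rightarrow> ('n \<Rightarrow> 'n \<Rightarrow> real) \<Rightarrow> ('n \<Rightarrow> 'n \<Rightarrow> real)
    \<Rightarrow> ((real ^ 'n) \<times> (real ^ 'n ^ 'n) \<Rightarrow> (real ^ 'n) \<times> (real ^ 'n ^ 'n::finite)) \<Rightarrow> bool" where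
  "equilibrium_selection b \<rho> s f sel \<longleftrightarrow>
     (\<forall>x\<in>subsidies. (\<exists>p. nash_equilibrium b \<rho> s f x p) \<longrightarrow> nash_equilibrium b \<rho> s f x (sel x))"

definition differentiable_selection_near ::
  "('n \<Rightarrow> real) \<Rightarrow> real \<Rightarrow> ('n \<Rightarrow> 'n \<Rightarrow> real) \<Rightarrow> ('n \<Rightarrow> 'n \<Rightarrow> real)
    \<Rightarrow> ((real ^ 'n) \<times> (real ^ 'n ^ 'n) \<Rightarrow> (real ^ 'n) \<times> (real ^ 'n ^ 'n::finite))
    \<Rightarrow> (real ^ 'n) \<times> (real ^ 'n ^ 'n) \<Rightarrow> bool" where
  "differentiable_selection_near b \<rho> s f sel x \<longleftrightarrow>
     (\<exists>U. open U \<and> x \<in> U \<and>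
       (\<forall>y\<in>U \<inter> subsidies. \<exists>p. nash_equilibrium b \<rho> s f y p) \<and>
       sel differentiable_on (U \<inter> subsidies))"

definition objective :: "(real ^ 'n::finite \<Rightarrow> real) \<Rightarrow> bool" where
  "objective W \<longleftrightarrow>
     W differentiable_on {a. \<forall>i. a $ i \<ge> 0} \<and>
     (\<forall>a i t. (\<forall>k. a $ k \<ge> 0) \<and> t > 0 \<longrightarrow> W a < W (a + t *\<^sub>R axis i 1))"

definition welfare ::
  "('n \<Rightarrow> real) \<Rightarrow> real \<Rightarrow> ('n \<Rightarrow> 'n \<Rightarrow> real) \<Rightarrow> ('n \<Rightarrow> 'n \<Rightarrow> real)
    \<Rightarrow> (real ^ 'n \<Rightarrow> real)
    \<Rightarrow> ((real ^ 'n) \<times> (real ^ 'n ^ 'n) \<Rightarrow> (real ^ 'n) \<times> (real ^ 'n ^ 'n::finite))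
    \<Rightarrow> (real ^ 'n) \<times> (real ^ 'n ^ 'n) \<Rightarrow> ereal" where
  "welfare b \<rho> s f W sel x =
     (if \<exists>p. nash_equilibrium b \<rho> s f x p then ereal (W (fst (sel x))) else - \<infinity>)"

definition optimal_subsidy ::
  "('n \<Rightarrow> real) \<Rightarrow> real \<Rightarrow> ('n \<Rightarrow> 'n \<Rightarrow> real) \<Rightarrow> ('n \<Rightarrow> 'n \<Rightarrow> real)
    \<Rightarrow> (real ^ 'n \<Rightarrow> real) \<Rightarrow> real
    \<Rightarrow> ((real ^ 'n) \<times> (real ^ 'n ^ 'n) \<Rightarrow> (real ^ 'n) \<times> (real ^ 'n ^ 'n::finite))
    \<Rightarrow> (real ^ 'n) \<times> (real ^ 'n ^ 'n) \<Rightarrow> bool" where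
  "optimal_subsidy b \<rho> s f W B sel x \<longleftrightarrow>
     x \<in> subsidies \<and> (\<exists>p. nash_equilibrium b \<rho> s f x p) \<and> payment x (sel x) \<le> B \<and>
     (\<forall>y\<in>subsidies. payment y (sel y) \<le> B \<longrightarrow>
        welfare b \<rho> s f W sel y \<le> welfare b \<rho> s f W sel x)"

definition lagrangian ::
  "(real ^ 'n \<Rightarrow> real) \<Rightarrow> real
    \<Rightarrow> ((real ^ 'n) \<times> (real ^ 'n ^ 'n) \<Rightarrow> (real ^ 'n) \<times> (real ^ 'n ^ 'n::finite))
    \<Rightarrow> (real ^ 'n) \<times> (real ^ 'n ^ 'n) \<Rightarrow> real" where
  "lagrangian W l sel x = W (fst (sel x)) - l * payment x (sel x)"

text \<open>
  Derivative of \<open>F\<close> at \<open>x\<close> in direction \<open>d\<close>, relative to the set of subsidies: for a coordinate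
  direction it is a two-sided partial derivative if that coordinate of \<open>x\<close> is positive, and the
  right-sided one if it is zero.
\<close>

definition has_subsidy_derivative ::
  "((real ^ 'n) \<times> (real ^ 'n ^ 'n) \<Rightarrow> real) \<Rightarrow> (real ^ 'n) \<times> (real ^ 'n ^ 'n::finite)
    \<Rightarrow> (real ^ 'n) \<times> (real ^ 'n ^ 'n) \<Rightarrow> real \<Rightarrow> bool" where
  "has_subsidy_derivative F x d D \<longleftrightarrow>
     ((\<lambda>t. F (x + t *\<^sub>R d)) has_real_derivative D) (at 0 within {t. x + t *\<^sub>R d \<in> subsidies})"

definition budget_strictly_binds ::
  "(real ^ 'n \<Rightarrow> real) \<Rightarrow> real
    \<Rightarrow> ((real ^ 'n) \<times> (real ^ 'n ^ 'n) \<Rightarrow> (real ^ 'n) \<times> (real ^ 'n ^ 'n::finite))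
    \<Rightarrow> (real ^ 'n) \<times> (real ^ 'n ^ 'n) \<Rightarrow> bool" where
  "budget_strictly_binds W B sel x \<longleftrightarrow>
     payment x (sel x) = B \<and>
     (\<exists>l>0.
       (\<forall>k. \<exists>D. has_subsidy_derivative (lagrangian W l sel) x (axis k 1, 0) D \<and>
          D \<le> 0 \<and> (fst x $ k > 0 \<longrightarrow> D = 0)) \<and>
       (\<forall>k m. k \<noteq> m \<longrightarrow>
          (\<exists>D. has_subsidy_derivative (lagrangian W l sel) x (0, axis k (axis m 1)) D \<and>
             D \<le> 0 \<and> (snd x $ k $ m > 0 \<longrightarrow> D = 0))))"

end

theory Submission
  imports Defs
begin

text \<open>
  Suppose \<open>\<sigma> $ i $ j = \<sigma> $ j $ i = 0\<close>. Raising both link subsidies by \<open>\<epsilon>\<close> while lowering \<open>\<beta> $ i\<close> and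
  \<open>\<beta> $ j\<close> by \<open>2\<rho>\<epsilon> a $ j / f i j\<close> and \<open>2\<rho>\<epsilon> a $ i / f i j\<close> leaves all actions unchanged to first
  order, whereas the payment changes by \<open>4\<epsilon> s i j / f i j < 0\<close>. So the Lagrangian increases in this
  direction, contradicting the first-order conditions.

  A corner link \<open>g $ k $ l = 0\<close> may sit exactly at its kink. Differentiability of the selection
  on a cone with nonempty interior then forces one of the two one-sided linearisations to hold in all
  directions, so the equilibrium conditions still linearise.
\<close>

subsection \<open>Derivatives along feasible rays\<close>

text \<open>\<open>S\<close> need not be a neighbourhood of \<open>x\<close>, so the chain rule is
  applied within the set \<open>T\<close> of positive feasible parameters. Since small positive
  parameters are all feasible, the filter at 0 within \<open>T\<close> is
  \<open>at_right 0\<close>.\<close>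

lemma has_derivative_along_ray:
  fixes F :: "'a::real_normed_vector \<Rightarrow> real"
  assumes F: "(F has_derivative F') (at x within S)"
    and ray: "\<forall>\<^sub>F t in at_right 0. x + t *\<^sub>R c \<in> S"
  shows "((\<lambda>t. (F (x + t *\<^sub>R c) - F x) / t) \<longlongrightarrow> F' c) (at_right 0)"
proof -
  define T where "T = {t. 0 < t \<and> x + t *\<^sub>R c \<in> S}"
  obtain r where r: "r > 0" "\<And>t. 0 < t \<Longrightarrow> t < r \<Longrightarrow> x + t *\<^sub>R c \<in> S"
    using ray by (auto simp: eventually_at_right_field)
  have lin: "linear F'"
    using F has_derivative_linear by blast
  have "((\<lambda>t. x + t *\<^sub>R c) has_derivative (\<lambda>t. t *\<^sub>R c)) (at 0 within T)"
    by (auto intro!: derivative_eq_intros)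
  moreover have "(F has_derivative F') (at (x + 0 *\<^sub>R c) within (\<lambda>t. x + t *\<^sub>R c) ` T)"
    using F by (auto simp: T_def intro: has_derivative_subset)
  ultimately have "((\<lambda>t. F (x + t *\<^sub>R c)) has_derivative (\<lambda>t. F' (t *\<^sub>R c))) (at 0 within T)"
    using diff_chain_within[of "\<lambda>t. x + t *\<^sub>R c" "\<lambda>t. t *\<^sub>R c" 0 T F F'] by (simp add: o_def)
  moreover have "(\<lambda>t. F' (t *\<^sub>R c)) = (*) (F' c)"
    using lin by (auto simp: linear_cmul)
  ultimately have "((\<lambda>t. F (x + t *\<^sub>R c)) has_real_derivative F' c) (at 0 within T)"
    by (simp add: has_field_derivative_def)
  then have "((\<lambda>t. (F (x + t *\<^sub>R c) - F x) / t) \<longlongrightarrow> F' c) (at 0 within T)"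
    by (simp add: has_field_derivative_iff)
  moreover have "at 0 within T = at_right 0"
    by (rule at_within_nhd[of _ "{-r<..<r}"]) (use r in \<open>auto simp: T_def\<close>)
  ultimately show ?thesis
    by simp
qed

text \<open>Lets an equation valid only on \<open>S\<close> be differentiated: the difference
  quotients vanish along every ray that stays in \<open>S\<close>.\<close>

lemma derivative_eq_0_along_ray:
  fixes F :: "'a::real_normed_vector \<Rightarrow> real"
  assumes F: "(F has_derivative F') (at x within S)"
    and ray: "\<forall>\<^sub>F t in at_right 0. x + t *\<^sub>R c \<in> S"
    and "x \<in> S" and zero: "\<And>y. y \<in> S \<Longrightarrow> F y = 0"
  shows "F' c = 0"
proof -
  have "\<forall>\<^sub>F t in at_right 0. (F (x + t *\<^sub>R c) - F x) / t = 0"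
    using ray by eventually_elim (simp add: zero \<open>x \<in> S\<close>)
  then have "((\<lambda>t. (F (x + t *\<^sub>R c) - F x) / t) \<longlongrightarrow> 0) (at_right 0)"
    by (rule tendsto_eventually)
  then show ?thesis
    using has_derivative_along_ray[OF F ray] tendsto_unique trivial_limit_at_right_real by blast
qed

text \<open>\<open>F x\<close> being nonzero forces \<open>H x = 0\<close>, so only one term of the
  product rule survives. This handles complementary slackness away from the kink.\<close>

lemma derivative_of_vanishing_factor:
  fixes F H :: "'a::real_normed_vector \<Rightarrow> real"
  assumes F: "(F has_derivative p) (at x within S)" and H: "(H has_derivative q) (at x within S)"
    and ray: "\<forall>\<^sub>F t in at_right 0. x + t *\<^sub>R c \<in> S"
    and "x \<in> S" and zero: "\<And>y. y \<in> S \<Longrightarrow> F y * H y = 0" and "F x \<noteq> 0"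
  shows "q c = 0"
proof -
  have "F x * q c + p c * H x = 0"
    using derivative_eq_0_along_ray[OF has_derivative_mult[OF F H] ray] assms by blast
  then show ?thesis
    using zero[OF \<open>x \<in> S\<close>] \<open>F x \<noteq> 0\<close> by simp
qed

text \<open>Directions \<open>c\<close> and \<open>d\<close> with \<open>p c > 0\<close> and \<open>q d > 0\<close> would give \<open>p\<close> and \<open>q\<close> both positive
  at \<open>c + d\<close>, although their product vanishes there.\<close>
lemma complementary_derivatives:
  fixes F H :: "'a::real_normed_vector \<Rightarrow> real"
  assumes F: "(F has_derivative p) (at x within S)" and H: "(H has_derivative q) (at x within S)"
    and ray: "\<And>c. c \<in> K \<Longrightarrow> \<forall>\<^sub>F t in at_right 0. x + t *\<^sub>R c \<in> S"
    and add: "\<And>c d. c \<in> K \<Longrightarrow> d \<in> K \<Longrightarrow> c + d \<in> K"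
    and "x \<in> S" and zero: "\<And>y. y \<in> S \<Longrightarrow> F y * H y = 0"
    and nonneg: "\<And>y. y \<in> S \<Longrightarrow> F y \<ge> 0" "\<And>y. y \<in> S \<Longrightarrow> H y \<ge> 0"
  shows "(\<forall>c\<in>K. p c = 0) \<or> (\<forall>c\<in>K. q c = 0)"
proof -
  consider "F x \<noteq> 0" | "H x \<noteq> 0" | "F x = 0" "H x = 0"
    by blast
  then show ?thesis
  proof cases
    case 1
    then show ?thesis
      using derivative_of_vanishing_factor[OF F H ray \<open>x \<in> S\<close> zero] by blast
  next
    case 2
    have "\<And>y. y \<in> S \<Longrightarrow> H y * F y = 0"
      using zero by (simp add: mult.commute)
    then show ?thesis
      using derivative_of_vanishing_factor[OF H F ray \<open>x \<in> S\<close>] 2 by blast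
  next
    case 3
    have lim: "((\<lambda>t. F (x + t *\<^sub>R c) / t) \<longlongrightarrow> p c) (at_right 0)"
      "((\<lambda>t. H (x + t *\<^sub>R c) / t) \<longlongrightarrow> q c) (at_right 0)" if "c \<in> K" for c
      using has_derivative_along_ray[OF F ray[OF that]] has_derivative_along_ray[OF H ray[OF that]] 3
      by simp_all
    have ev: "\<forall>\<^sub>F t in at_right 0. t > 0 \<and> x + t *\<^sub>R c \<in> S" if "c \<in> K" for c
      using ray[OF that] eventually_at_right_less[of "0::real"] by eventually_elim auto
    have p: "p c \<ge> 0" if "c \<in> K" for c
      by (rule tendsto_lowerbound[OF lim(1)[OF that]])
        (use ev[OF that] nonneg in \<open>auto elim!: eventually_mono\<close>)
    have q: "q c \<ge> 0" if "c \<in> K" for c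
      by (rule tendsto_lowerbound[OF lim(2)[OF that]])
        (use ev[OF that] nonneg in \<open>auto elim!: eventually_mono\<close>)
    have pq: "p c * q c = 0" if "c \<in> K" for c
    proof -
      have "\<forall>\<^sub>F t in at_right 0. F (x + t *\<^sub>R c) / t * (H (x + t *\<^sub>R c) / t) = 0"
        using ev[OF that] by eventually_elim (use zero in auto)
      then have "((\<lambda>t. F (x + t *\<^sub>R c) / t * (H (x + t *\<^sub>R c) / t)) \<longlongrightarrow> 0) (at_right 0)"
        by (rule tendsto_eventually)
      then show ?thesis
        using tendsto_mult[OF lim[OF that]] tendsto_unique trivial_limit_at_right_real by blast
    qed
    show ?thesis
    proof (rule ccontr)
      assume "\<not> ?thesis"
      then obtain c d where "c \<in> K" "p c \<noteq> 0" "d \<in> K" "q d \<noteq> 0"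
        by blast
      then have "p (c + d) > 0" "q (c + d) > 0"
        using p[of c] p[of d] q[of c] q[of d] F H
        by (auto dest!: has_derivative_linear simp: linear_add)
      then show False
        using pq[OF add[OF \<open>c \<in> K\<close> \<open>d \<in> K\<close>]] by simp
    qed
  qed
qed

subsection \<open>Subsidies and equilibria\<close>

lemma subsidies_add: "x \<in> subsidies \<Longrightarrow> y \<in> subsidies \<Longrightarrow> x + y \<in> subsidies"
  by (auto simp: subsidies_def)

lemma subsidies_scaleR: "x \<in> subsidies \<Longrightarrow> t \<ge> 0 \<Longrightarrow> t *\<^sub>R x \<in> subsidies"
  by (auto simp: subsidies_def)

lemma subsidies_add_scaleR:
  "x \<in> subsidies \<Longrightarrow> c \<in> subsidies \<Longrightarrow> t > 0 \<Longrightarrow> x + t *\<^sub>R c \<in> subsidies"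
  by (simp add: subsidies_add subsidies_scaleR)

lemma action_subsidy_in_subsidies: "(\<forall>k. v $ k \<ge> 0) \<Longrightarrow> (v, 0) \<in> subsidies"
  by (simp add: subsidies_def)

lemma link_subsidy_in_subsidies: "k \<noteq> l \<Longrightarrow> (0, axis k (axis l 1)) \<in> subsidies"
  by (auto simp: subsidies_def axis_def)

lemma eventually_ray_in_subsidies:
  assumes "open U" "x \<in> U" "x \<in> subsidies" "c \<in> subsidies"
  shows "\<forall>\<^sub>F t in at_right 0. x + t *\<^sub>R c \<in> U \<inter> subsidies"
proof -
  have "((\<lambda>t. x + t *\<^sub>R c) \<longlongrightarrow> x + 0 *\<^sub>R c) (at_right 0)"
    by (intro tendsto_intros)
  then have "\<forall>\<^sub>F t in at_right 0. x + t *\<^sub>R c \<in> U"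
    using assms by (simp add: topological_tendstoD)
  then show ?thesis
    using eventually_at_right_less[of "0::real"]
    by eventually_elim (use assms in \<open>auto intro: subsidies_add_scaleR\<close>)
qed

text \<open>Connects the Kuhn-Tucker conditions with the total derivative of the Lagrangian:
  restricted to positive parameters, both derivatives are limits of the same right-sided difference
  quotients.\<close>

lemma has_subsidy_derivative_unique:
  assumes F: "(F has_derivative F') (at x within U \<inter> subsidies)"
    and U: "open U" "x \<in> U" and x: "x \<in> subsidies" and c: "c \<in> subsidies"
    and D: "has_subsidy_derivative F x c D"
  shows "D = F' c"
proof -
  have "((\<lambda>t. F (x + t *\<^sub>R c)) has_real_derivative D) (at 0 within {t. x + t *\<^sub>R c \<in> subsidies})"
    using D by (simp add: has_subsidy_derivative_def)
  then have "((\<lambda>t. F (x + t *\<^sub>R c)) has_real_derivative D) (at_right 0)"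
    by (rule DERIV_subset) (use x c in \<open>auto intro: subsidies_add_scaleR\<close>)
  then have "((\<lambda>t. (F (x + t *\<^sub>R c) - F x) / t) \<longlongrightarrow> D) (at_right 0)"
    by (simp add: has_field_derivative_iff)
  then show ?thesis
    using has_derivative_along_ray[OF F eventually_ray_in_subsidies[OF U x c]]
      tendsto_unique trivial_limit_at_right_real by blast
qed

text \<open>The maximizer over the half-line is \<open>max 0 m / c\<close>. Applied with
  \<open>c = 1\<close> to actions and with \<open>c = f k l\<close> to link intensities.\<close>

lemma concave_quadratic_maximizer:
  fixes m c t :: real
  assumes "c > 0" "t \<ge> 0"
    and max: "\<And>u. u \<ge> 0 \<Longrightarrow> m * u - c * u\<^sup>2 / 2 \<le> m * t - c * t\<^sup>2 / 2"
  shows "c * t - m \<ge> 0" "t * (c * t - m) = 0"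
proof -
  have "c * t = max 0 m"
  proof (cases "m \<ge> 0")
    case True
    \<comment> \<open>The unconstrained maximizer; the objective at \<open>u\<close> exceeds that at
      \<open>t\<close> by half of \<open>c * (t - u)\<^sup>2\<close>.\<close>
    define u where "u = m / c"
    have m: "m = c * u" and "u \<ge> 0"
      using True \<open>c > 0\<close> by (simp_all add: u_def)
    have "c * (t - u)\<^sup>2 \<le> 0"
      using max[OF \<open>u \<ge> 0\<close>] by (simp add: m power2_eq_square algebra_simps)
    then have "(t - u)\<^sup>2 = 0"
      using \<open>c > 0\<close> by (simp add: mult_le_0_iff)
    then show ?thesis
      using True m by simp
  next
    case False
    have "m * t \<ge> c * t\<^sup>2 / 2"
      using max[of 0] by simp
    moreover have "c * t\<^sup>2 / 2 \<ge> 0"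
      using \<open>c > 0\<close> by simp
    ultimately have "m * t \<ge> 0"
      by linarith
    then have "t = 0"
      using False \<open>t \<ge> 0\<close> by (auto simp: zero_le_mult_iff)
    then show ?thesis
      using False by simp
  qed
  then show "c * t - m \<ge> 0" "t * (c * t - m) = 0"
    using \<open>c > 0\<close> by (auto simp: max_def split: if_splits)
qed

text \<open>Grouping by links makes the utility visibly quadratic in the agent's own action and in
  each of the agent's own intensities.\<close>

lemma utility_eq_sum_over_links:
  "utility b \<rho> s f (\<beta>, \<sigma>) k (a, g) = (b k + \<beta> $ k) * a $ k - (a $ k)\<^sup>2 / 2
     + (\<Sum>l\<in>UNIV - {k}. (\<rho> * a $ k * a $ l + s k l + \<sigma> $ k $ l) * (g $ k $ l + g $ l $ k)
          - f k l * (g $ k $ l)\<^sup>2 / 2)"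
proof -
  have "(\<Sum>l\<in>UNIV - {k}. (\<rho> * a $ k * a $ l + s k l + \<sigma> $ k $ l) * (g $ k $ l + g $ l $ k)
          - f k l * (g $ k $ l)\<^sup>2 / 2)
     = \<rho> * (\<Sum>l\<in>UNIV - {k}. link_strength g k l * a $ k * a $ l)
       + (\<Sum>l\<in>UNIV - {k}. s k l * link_strength g k l)
       - (\<Sum>l\<in>UNIV - {k}. f k l * (g $ k $ l)\<^sup>2 / 2)
       + (\<Sum>l\<in>UNIV - {k}. \<sigma> $ k $ l * link_strength g k l)"
    unfolding sum_distrib_left sum.distrib[symmetric] sum_subtractf[symmetric]
    by (rule sum.cong) (auto simp: link_strength_def algebra_simps)
  then show ?thesis
    by (simp add: utility_def base_utility_def algebra_simps)
qed

text \<open>Deviations in the action alone face a concave quadratic with slope \<open>m\<close> at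
  zero. Since \<open>b k > 0\<close> makes \<open>m\<close> positive, the corner at zero is excluded
  and the first-order condition is an equation.\<close>

lemma nash_equilibrium_action:
  assumes nash: "nash_equilibrium b \<rho> s f (\<beta>, \<sigma>) (a, g)" and "b k > 0" "\<rho> > 0"
    and sub: "(\<beta>, \<sigma>) \<in> subsidies"
  shows "a $ k = b k + \<beta> $ k + \<rho> * (\<Sum>l\<in>UNIV - {k}. (g $ k $ l + g $ l $ k) * a $ l)"
proof -
  define m where "m = b k + \<beta> $ k + \<rho> * (\<Sum>l\<in>UNIV - {k}. (g $ k $ l + g $ l $ k) * a $ l)"
  have prof: "\<And>k. a $ k \<ge> 0" "\<And>k l. g $ k $ l \<ge> 0" "\<And>k. g $ k $ k = 0"
    using nash by (auto simp: nash_equilibrium_def profiles_def)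
  have "(\<Sum>l\<in>UNIV - {k}. (g $ k $ l + g $ l $ k) * a $ l) \<ge> 0"
    by (intro sum_nonneg mult_nonneg_nonneg add_nonneg_nonneg prof)
  moreover have "\<beta> $ k \<ge> 0"
    using sub by (simp add: subsidies_def)
  ultimately have "m > 0"
    using \<open>b k > 0\<close> \<open>\<rho> > 0\<close> by (simp add: m_def add_pos_nonneg)
  \<comment> \<open>The part of the utility that \<open>k\<close>'s own action does not
    affect.\<close>
  define C where "C = (\<Sum>l\<in>UNIV - {k}. (s k l + \<sigma> $ k $ l) * (g $ k $ l + g $ l $ k)
          - f k l * (g $ k $ l)\<^sup>2 / 2)"
  have u: "utility b \<rho> s f (\<beta>, \<sigma>) k (a', g) = m * a' $ k - 1 * (a' $ k)\<^sup>2 / 2 + C"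
    if "\<And>l. l \<noteq> k \<Longrightarrow> a' $ l = a $ l" for a'
  proof -
    have "(\<Sum>l\<in>UNIV - {k}. (\<rho> * a' $ k * a' $ l + s k l + \<sigma> $ k $ l) * (g $ k $ l + g $ l $ k)
          - f k l * (g $ k $ l)\<^sup>2 / 2)
      = \<rho> * (\<Sum>l\<in>UNIV - {k}. (g $ k $ l + g $ l $ k) * a $ l) * a' $ k + C"
      unfolding C_def sum_distrib_left sum_distrib_right sum.distrib[symmetric]
      by (rule sum.cong) (auto simp: that algebra_simps)
    then show ?thesis
      by (simp add: utility_eq_sum_over_links m_def algebra_simps)
  qed
  have max: "m * t - 1 * t\<^sup>2 / 2 \<le> m * a $ k - 1 * (a $ k)\<^sup>2 / 2" if "t \<ge> 0" for t
  proof -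
    define a' where "a' = (\<chi> l. if l = k then t else a $ l)"
    have "deviation k (a, g) (a', g)"
      using prof that by (auto simp: deviation_def profiles_def a'_def)
    then have "utility b \<rho> s f (\<beta>, \<sigma>) k (a', g) \<le> utility b \<rho> s f (\<beta>, \<sigma>) k (a, g)"
      using nash by (auto simp: nash_equilibrium_def)
    then show ?thesis
      using u[of a'] u[of a] by (simp add: a'_def)
  qed
  have "1 * a $ k - m \<ge> 0" "a $ k * (1 * a $ k - m) = 0"
    using concave_quadratic_maximizer[of 1 "a $ k" m] max prof by auto
  then show ?thesis
    using \<open>m > 0\<close> by (auto simp: m_def)
qed

text \<open>Changing a single intensity again faces a concave quadratic, but its slope
  \<open>m\<close> at zero may be negative since \<open>s k l\<close> may be. So only complementary
  slackness is available.\<close>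

lemma nash_equilibrium_link:
  assumes nash: "nash_equilibrium b \<rho> s f (\<beta>, \<sigma>) (a, g)" and "k \<noteq> l" "f k l > 0"
  shows "f k l * g $ k $ l - (\<rho> * a $ k * a $ l + s k l + \<sigma> $ k $ l) \<ge> 0"
    and "g $ k $ l * (f k l * g $ k $ l - (\<rho> * a $ k * a $ l + s k l + \<sigma> $ k $ l)) = 0"
proof -
  define m where "m = \<rho> * a $ k * a $ l + s k l + \<sigma> $ k $ l"
  have prof: "\<And>k. a $ k \<ge> 0" "\<And>k l. g $ k $ l \<ge> 0" "\<And>k. g $ k $ k = 0"
    using nash by (auto simp: nash_equilibrium_def profiles_def)
  \<comment> \<open>The term \<open>m * g $ l $ k\<close> belongs to the constant: the link strength
    includes the partner's intensity, which \<open>k\<close> does not control.\<close>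
  define C where "C = (b k + \<beta> $ k) * a $ k - (a $ k)\<^sup>2 / 2 + m * g $ l $ k
     + (\<Sum>h\<in>UNIV - {k} - {l}. (\<rho> * a $ k * a $ h + s k h + \<sigma> $ k $ h) * (g $ k $ h + g $ h $ k)
          - f k h * (g $ k $ h)\<^sup>2 / 2)"
  have u: "utility b \<rho> s f (\<beta>, \<sigma>) k (a, g') = m * g' $ k $ l - f k l * (g' $ k $ l)\<^sup>2 / 2 + C"
    if "\<And>p q. p \<noteq> k \<or> q \<noteq> l \<Longrightarrow> g' $ p $ q = g $ p $ q" for g'
  proof -
    have "(\<Sum>h\<in>UNIV - {k} - {l}. (\<rho> * a $ k * a $ h + s k h + \<sigma> $ k $ h) * (g' $ k $ h + g' $ h $ k)
          - f k h * (g' $ k $ h)\<^sup>2 / 2)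
      = (\<Sum>h\<in>UNIV - {k} - {l}. (\<rho> * a $ k * a $ h + s k h + \<sigma> $ k $ h) * (g $ k $ h + g $ h $ k)
          - f k h * (g $ k $ h)\<^sup>2 / 2)"
      by (rule sum.cong) (auto simp: that)
    moreover have "l \<in> UNIV - {k}"
      using \<open>k \<noteq> l\<close> by simp
    ultimately show ?thesis
      using \<open>k \<noteq> l\<close> that[of l k]
      by (simp add: utility_eq_sum_over_links sum.remove[of "UNIV - {k}" l] C_def m_def algebra_simps)
  qed
  have max: "m * t - f k l * t\<^sup>2 / 2 \<le> m * g $ k $ l - f k l * (g $ k $ l)\<^sup>2 / 2" if "t \<ge> 0" for t
  proof -
    define g' where "g' = (\<chi> p q. if p = k \<and> q = l then t else g $ p $ q)"
    have "deviation k (a, g) (a, g')"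
      using prof that \<open>k \<noteq> l\<close> by (auto simp: deviation_def profiles_def g'_def vec_eq_iff)
    moreover have g': "g' $ k $ l = t" "\<And>p q. p \<noteq> k \<or> q \<noteq> l \<Longrightarrow> g' $ p $ q = g $ p $ q"
      by (auto simp: g'_def)
    ultimately have "utility b \<rho> s f (\<beta>, \<sigma>) k (a, g') \<le> utility b \<rho> s f (\<beta>, \<sigma>) k (a, g)"
      using nash by (auto simp: nash_equilibrium_def)
    then show ?thesis
      using u[OF g'(2)] u[of g] g'(1) by simp
  qed
  show "f k l * g $ k $ l - (\<rho> * a $ k * a $ l + s k l + \<sigma> $ k $ l) \<ge> 0"
    and "g $ k $ l * (f k l * g $ k $ l - (\<rho> * a $ k * a $ l + s k l + \<sigma> $ k $ l)) = 0"
    using concave_quadratic_maximizer[of "f k l" "g $ k $ l" m] max prof \<open>f k l > 0\<close>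
    by (auto simp: m_def)
qed

theorem proposition3:
  fixes b :: "'n::finite \<Rightarrow> real"
    and \<rho> :: real
    and s f :: "'n \<Rightarrow> 'n \<Rightarrow> real"
    and W :: "real ^ 'n \<Rightarrow> real"
    and B :: real
    and sel :: "(real ^ 'n) \<times> (real ^ 'n ^ 'n) \<Rightarrow> (real ^ 'n) \<times> (real ^ 'n ^ 'n)"
    and \<beta> :: "real ^ 'n"
    and \<sigma> :: "real ^ 'n ^ 'n"
    and i j :: 'n
  assumes "\<And>k. b k > 0"
    and "\<rho> > 0"
    and "\<And>k l. k \<noteq> l \<Longrightarrow> s k l = s l k"
    and "\<And>k l. k \<noteq> l \<Longrightarrow> f k l = f l k"
    and "\<And>k l. k \<noteq> l \<Longrightarrow> f k l > 0"
    and "objective W"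
    and "B > 0"
    and "equilibrium_selection b \<rho> s f sel"
    and "optimal_subsidy b \<rho> s f W B sel (\<beta>, \<sigma>)"
    and "differentiable_selection_near b \<rho> s f sel (\<beta>, \<sigma>)"
    and "budget_strictly_binds W B sel (\<beta>, \<sigma>)"
    and "i \<noteq> j"
    and "s i j < 0"
    and "snd (sel (\<beta>, \<sigma>)) $ i $ j > 0"
    and "snd (sel (\<beta>, \<sigma>)) $ j $ i > 0"
    and "\<beta> $ i > 0"
    and "\<beta> $ j > 0"
  shows "\<sigma> $ i $ j + \<sigma> $ j $ i > 0"
proof -

  \<comment> \<open>The selected equilibrium and its derivative at the optimum\<close>
  define x where "x = (\<beta>, \<sigma>)"
  obtain U where U: "open U" "x \<in> U"
    and exists: "\<And>y. y \<in> U \<inter> subsidies \<Longrightarrow> \<exists>p. nash_equilibrium b \<rho> s f y p"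
    and "sel differentiable_on (U \<inter> subsidies)"
    using assms(10) by (auto simp: differentiable_selection_near_def x_def)
  define S where "S = U \<inter> subsidies"
  have x: "x \<in> subsidies" "x \<in> S"
    using assms(9) U by (auto simp: optimal_subsidy_def x_def S_def)
  obtain D where D: "(sel has_derivative D) (at x within S)"
    using \<open>sel differentiable_on (U \<inter> subsidies)\<close> x(2)
    by (auto simp: differentiable_on_def differentiable_def S_def)
  define a where "a = (\<lambda>y. fst (sel y))"
  define g where "g = (\<lambda>y. snd (sel y))"
  define A where "A = (\<lambda>c. fst (D c))"
  define \<Gamma> where "\<Gamma> = (\<lambda>c. snd (D c))"
  have ray: "\<forall>\<^sub>F t in at_right 0. x + t *\<^sub>R c \<in> S" if "c \<in> subsidies" for c
    using eventually_ray_in_subsidies[OF U x(1) that] by (simp add: S_def)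
  have nash: "nash_equilibrium b \<rho> s f (fst y, snd y) (a y, g y)" and sub: "(fst y, snd y) \<in> subsidies"
    if "y \<in> S" for y
    using assms(8) that exists by (auto simp: equilibrium_selection_def S_def a_def g_def)
  have prof: "g y $ k $ l \<ge> 0" "a y $ k \<ge> 0" if "y \<in> S" for y k l
    using nash[OF that] by (auto simp: nash_equilibrium_def profiles_def)

  have dD: "linear D"
    using D has_derivative_linear by blast
  then have linA: "linear A"
    by (auto simp: A_def linear_iff)
  have dA: "(a has_derivative A) (at x within S)"
    unfolding a_def A_def by (intro has_derivative_fst D)
  have da: "((\<lambda>y. a y $ k) has_derivative (\<lambda>c. A c $ k)) (at x within S)" for k
    by (rule bounded_linear.has_derivative[OF bounded_linear_vec_nth dA])
  have dg: "((\<lambda>y. g y $ k $ l) has_derivative (\<lambda>c. \<Gamma> c $ k $ l)) (at x within S)" for k l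
    unfolding g_def \<Gamma>_def
    by (intro bounded_linear.has_derivative[OF bounded_linear_vec_nth] has_derivative_snd D)
  have d\<beta>: "((\<lambda>y. fst y $ k) has_derivative (\<lambda>c. fst c $ k)) (at x within S)" for k
    by (intro bounded_linear.has_derivative[OF bounded_linear_vec_nth] has_derivative_fst
        has_derivative_ident)
  have d\<sigma>: "((\<lambda>y. snd y $ k $ l) has_derivative (\<lambda>c. snd c $ k $ l)) (at x within S)" for k l
    by (intro bounded_linear.has_derivative[OF bounded_linear_vec_nth] has_derivative_snd
        has_derivative_ident)
  note derivs = da dg d\<beta> d\<sigma>

  \<comment> \<open>Linearised equilibrium conditions\<close>
  have action: "A c $ k = fst c $ k + \<rho> * (\<Sum>l\<in>UNIV - {k}.
      (g x $ k $ l + g x $ l $ k) * A c $ l + (\<Gamma> c $ k $ l + \<Gamma> c $ l $ k) * a x $ l)"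
    if "c \<in> subsidies" for c k
  proof -
    have "((\<lambda>y. a y $ k - (b k + fst y $ k
        + \<rho> * (\<Sum>l\<in>UNIV - {k}. (g y $ k $ l + g y $ l $ k) * a y $ l)))
      has_derivative (\<lambda>c. A c $ k - (fst c $ k + \<rho> * (\<Sum>l\<in>UNIV - {k}.
        (g x $ k $ l + g x $ l $ k) * A c $ l + (\<Gamma> c $ k $ l + \<Gamma> c $ l $ k) * a x $ l))))
      (at x within S)"
      by (auto intro!: derivative_eq_intros derivs simp: algebra_simps)
    from derivative_eq_0_along_ray[OF this ray[OF that] x(2)] show ?thesis
      using nash_equilibrium_action[OF nash assms(1,2) sub] by simp
  qed

  define H where "H = (\<lambda>k l y. f k l * g y $ k $ l - (\<rho> * a y $ k * a y $ l + s k l + snd y $ k $ l))"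
  define H' where "H' = (\<lambda>k l c. f k l * \<Gamma> c $ k $ l
    - (\<rho> * (A c $ k * a x $ l + a x $ k * A c $ l) + snd c $ k $ l))"
  \<comment> \<open>Stated through the derivative rather than by \<open>g x $ k $ l > 0\<close>, so
    that a link at its kink is classified by which linearisation it obeys.\<close>
  define interior where "interior k l \<longleftrightarrow> (\<forall>c\<in>subsidies. H' k l c = 0)" for k l
  have dH: "(H k l has_derivative H' k l) (at x within S)" for k l
    unfolding H_def H'_def by (auto intro!: derivative_eq_intros derivs simp: algebra_simps)
  have compl: "g y $ k $ l * H k l y = 0" "H k l y \<ge> 0" if "y \<in> S" "k \<noteq> l" for y k l
    using nash_equilibrium_link[where f = f, OF nash[OF that(1)] that(2) assms(5)[OF that(2)]]
    by (auto simp: H_def)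
  have corner: "\<Gamma> c $ k $ l = 0" if "\<not> interior k l" "k \<noteq> l" "c \<in> subsidies" for c k l
    using complementary_derivatives[OF dg dH[of k l] ray subsidies_add x(2)] compl prof that
    unfolding interior_def by blast
  have interior: "interior k l" if "k \<noteq> l" "g x $ k $ l > 0" for k l
    using derivative_of_vanishing_factor[OF dg dH[of k l] ray x(2)] compl that
    unfolding interior_def by (metis less_irrefl)

  text \<open>\<open>M\<close> is the linearised equilibrium system in the actions, with the links eliminated. That
    the selection responds to every action subsidy makes \<open>M\<close> surjective, hence injective.\<close>
  define \<Delta> where "\<Delta> = (\<lambda>k l v.
      if interior k l then \<rho> * (v $ k * a x $ l + a x $ k * v $ l) / f k l else 0)"
  \<comment> \<open>The direct response of a link to its own subsidy; \<open>\<Delta>\<close> is the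
    response induced by changes in actions.\<close>
  define \<tau> where "\<tau> = (\<lambda>k l (c :: (real ^ 'n) \<times> (real ^ 'n ^ 'n)).
      if interior k l then snd c $ k $ l / f k l else 0)"
  have \<Gamma>: "\<Gamma> c $ k $ l = \<Delta> k l (A c) + \<tau> k l c" if "c \<in> subsidies" "k \<noteq> l" for c k l
  proof (cases "interior k l")
    case True
    then show ?thesis
      using that assms(5)[OF that(2)] by (simp add: interior_def H'_def \<Delta>_def \<tau>_def field_simps)
  next
    case False
    then show ?thesis
      using corner that by (simp add: \<Delta>_def \<tau>_def)
  qed
  define M where "M = (\<lambda>v. \<chi> k. v $ k - \<rho> * (\<Sum>l\<in>UNIV - {k}.
      (g x $ k $ l + g x $ l $ k) * v $ l + (\<Delta> k l v + \<Delta> l k v) * a x $ l))"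
  have MA: "M (A c) $ k = fst c $ k + \<rho> * (\<Sum>l\<in>UNIV - {k}. (\<tau> k l c + \<tau> l k c) * a x $ l)"
    if "c \<in> subsidies" for c k
  proof -
    have "(\<Sum>l\<in>UNIV - {k}. (g x $ k $ l + g x $ l $ k) * A c $ l + (\<Gamma> c $ k $ l + \<Gamma> c $ l $ k) * a x $ l)
      = (\<Sum>l\<in>UNIV - {k}.
      (g x $ k $ l + g x $ l $ k) * A c $ l + (\<Delta> k l (A c) + \<Delta> l k (A c)) * a x $ l)
      + (\<Sum>l\<in>UNIV - {k}. (\<tau> k l c + \<tau> l k c) * a x $ l)"
      unfolding sum.distrib[symmetric]
      by (rule sum.cong) (auto simp: \<Gamma>[OF that] algebra_simps)
    then show ?thesis
      using action[OF that, of k] by (simp add: M_def algebra_simps)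
  qed
  have "linear M"
  proof (rule linearI)
    have \<Delta>: "\<Delta> k l (v + w) = \<Delta> k l v + \<Delta> k l w" "\<Delta> k l (r *\<^sub>R v) = r * \<Delta> k l v" for k l v w r
      by (auto simp: \<Delta>_def algebra_simps add_divide_distrib)
    show "M (v + w) = M v + M w" for v w
      by (simp add: vec_eq_iff M_def \<Delta> algebra_simps sum.distrib)
    show "M (r *\<^sub>R v) = r *\<^sub>R M v" for r v
      by (simp add: vec_eq_iff M_def \<Delta> algebra_simps sum_distrib_left)
  qed
  \<comment> \<open>The response of actions to pure action subsidies, extended linearly to vectors
    with negative entries.\<close>
  define N where "N = (\<lambda>v. A (v, 0))"
  have "linear N"
  proof (rule linearI)
    show "N (v + w) = N v + N w" for v w
      using linear_add[OF linA, of "(v, 0)" "(w, 0)"] by (simp add: N_def)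
    show "N (r *\<^sub>R v) = r *\<^sub>R N v" for r v
      using linear_cmul[OF linA, of r "(v, 0)"] by (simp add: N_def)
  qed
  \<comment> \<open>\<open>MA\<close> is known only in nonnegative directions, but these contain the
    standard basis, and linearity does the rest.\<close>
  have "M \<circ> N = id"
  proof (rule linear_eq_stdbasis)
    show "linear (M \<circ> N)" "linear id"
      using \<open>linear M\<close> \<open>linear N\<close> by (auto intro: linear_compose linear_id)
    show "(M \<circ> N) v = id v" if "v \<in> Basis" for v
    proof -
      have "\<forall>k. v $ k \<ge> 0"
        using that by (auto simp: Basis_vec_def axis_def)
      moreover have "\<tau> k l (v, 0) = 0" for k l
        by (simp add: \<tau>_def)
      ultimately show ?thesis
        by (simp add: N_def vec_eq_iff MA action_subsidy_in_subsidies)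
    qed
  qed
  then have "N \<circ> M = id"
    using linear_inverse_left \<open>linear M\<close> \<open>linear N\<close> by blast
  then have inj: "v = w" if "M v = M w" for v w
    using that by (metis comp_apply id_apply)

  have fij: "f i j > 0" "f j i = f i j" "s j i = s i j"
    using assms(3,4,5,12) by auto
  show ?thesis
  proof (rule ccontr)

    \<comment> \<open>Two subsidy directions with the same effect on actions\<close>
    assume "\<not> ?thesis"
    moreover have "\<sigma> $ i $ j \<ge> 0" "\<sigma> $ j $ i \<ge> 0"
      using x(1) by (auto simp: subsidies_def x_def)
    ultimately have \<sigma>0: "\<sigma> $ i $ j = 0" "\<sigma> $ j $ i = 0"
      by linarith+
    have gpos: "g x $ i $ j > 0" "g x $ j $ i > 0"
      using assms(14,15) by (simp_all add: g_def x_def)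
    \<comment> \<open>Both intensities are positive, so complementary slackness turns into
      equations; with zero link subsidies they are the same at both ends.\<close>
    have gval: "f i j * g x $ i $ j = \<rho> * a x $ i * a x $ j + s i j"
      "f i j * g x $ j $ i = \<rho> * a x $ i * a x $ j + s i j"
      using compl(1)[OF x(2) assms(12)] compl(1)[OF x(2) assms(12)[symmetric]] gpos \<sigma>0 fij
      by (simp_all add: H_def x_def)
    have int: "interior i j" "interior j i"
      using interior assms(12) gpos by auto

    text \<open>\<open>p\<close> subsidises the link from both ends; \<open>q\<close> is the action subsidy with the same
      first-order effect on actions.\<close>
    define p1 :: "(real ^ 'n) \<times> (real ^ 'n ^ 'n)" where "p1 = (0, axis i (axis j 1))"
    define p2 :: "(real ^ 'n) \<times> (real ^ 'n ^ 'n)" where "p2 = (0, axis j (axis i 1))"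
    define q1 :: "(real ^ 'n) \<times> (real ^ 'n ^ 'n)" where "q1 = (axis i 1, 0)"
    define q2 :: "(real ^ 'n) \<times> (real ^ 'n ^ 'n)" where "q2 = (axis j 1, 0)"
    \<comment> \<open>Subsidising both ends directly strengthens the link by
      \<open>2 / f i j\<close>, which raises \<open>i\<close>'s marginal return to action by
      \<open>\<gamma> * a x $ j\<close> and \<open>j\<close>'s by
      \<open>\<gamma> * a x $ i\<close>.\<close>
    define \<gamma> where "\<gamma> = 2 * \<rho> / f i j"
    define p where "p = p1 + p2"
    define q where "q = (\<gamma> * a x $ j) *\<^sub>R q1 + (\<gamma> * a x $ i) *\<^sub>R q2"
    have in1: "p1 \<in> subsidies" "p2 \<in> subsidies" "q1 \<in> subsidies" "q2 \<in> subsidies"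
      using link_subsidy_in_subsidies[OF assms(12)] link_subsidy_in_subsidies[OF assms(12)[symmetric]]
      unfolding p1_def p2_def q1_def q2_def
      by (auto intro!: action_subsidy_in_subsidies simp: axis_def[of _ "1::real"])
    then have in2: "p \<in> subsidies" "q \<in> subsidies"
      unfolding p_def q_def using assms(2) fij(1) prof(2)[OF x(2)]
      by (auto intro!: subsidies_add subsidies_scaleR simp: \<gamma>_def)
    have \<tau>p: "\<tau> k l p = (if k = i \<and> l = j \<or> k = j \<and> l = i then 1 / f i j else 0)" for k l
      using int fij assms(12) by (auto simp: \<tau>_def p_def p1_def p2_def axis_def)
    have \<tau>q: "\<tau> k l q = 0" for k l
      by (simp add: \<tau>_def q_def q1_def q2_def)
    have fstq: "fst q $ k = (if k = i then \<gamma> * a x $ j else if k = j then \<gamma> * a x $ i else 0)" for k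
      using assms(12) by (auto simp: q_def q1_def q2_def axis_def)
    have "M (A p) = M (A q)"
    proof -
      \<comment> \<open>Only the term of the partner can be nonzero. For \<open>k\<close> outside
        \<open>{i, j}\<close> the index \<open>i\<close> is a dummy carrying the value 0, so one
        formula covers all \<open>k\<close>.\<close>
      have "(\<Sum>l\<in>UNIV - {k}. (\<tau> k l p + \<tau> l k p) * a x $ l)
        = (\<Sum>l\<in>UNIV - {k}. if l = (if k = i then j else i)
             then (if k = i then 2 / f i j * a x $ j else if k = j then 2 / f i j * a x $ i else 0) else 0)" for k
        by (rule sum.cong) (use assms(12) in \<open>auto simp: \<tau>p\<close>)
      then have "\<rho> * (\<Sum>l\<in>UNIV - {k}. (\<tau> k l p + \<tau> l k p) * a x $ l) = fst q $ k" for k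
        using assms(12) by (auto simp: fstq \<gamma>_def)
      moreover have "fst p = 0"
        by (simp add: p_def p1_def p2_def)
      ultimately show ?thesis
        by (simp add: vec_eq_iff MA in2 \<tau>q)
    qed
    then have Apq: "A p = A q"
      by (rule inj)
    have \<Gamma>pq: "\<Gamma> p $ k $ l = \<Gamma> q $ k $ l + \<tau> k l p" if "k \<noteq> l" for k l
      using \<Gamma>[OF in2(1) that] \<Gamma>[OF in2(2) that] by (simp add: Apq \<tau>q)

    \<comment> \<open>First-order change of the payment\<close>
    define R where "R = (\<lambda>c k l. snd c $ k $ l * (g x $ k $ l + g x $ l $ k)
       + \<sigma> $ k $ l * (\<Gamma> c $ k $ l + \<Gamma> c $ l $ k))"
    define P' where "P' = (\<lambda>c. (\<Sum>k\<in>UNIV. fst c $ k * a x $ k + \<beta> $ k * A c $ k) + (\<Sum>k\<in>UNIV. \<Sum>l\<in>UNIV - {k}. R c k l))"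
    have payment: "payment y (sel y) = (\<Sum>k\<in>UNIV. fst y $ k * a y $ k)
       + (\<Sum>k\<in>UNIV. \<Sum>l\<in>UNIV - {k}. snd y $ k $ l * (g y $ k $ l + g y $ l $ k))" for y
      by (auto simp: payment_def link_strength_def a_def g_def split: prod.split intro!: sum.cong)
    have \<beta>\<sigma>: "\<beta> = fst x" "\<sigma> = snd x"
      by (simp_all add: x_def)
    then have dP: "((\<lambda>y. payment y (sel y)) has_derivative P') (at x within S)"
      unfolding payment P'_def R_def
      by (auto intro!: derivative_eq_intros derivs sum.cong simp: algebra_simps sum.distrib)
    have P'pq: "P' p - P' q < 0"
    proof -
      have "snd p $ k $ l = (if k = i \<and> l = j \<or> k = j \<and> l = i then 1 else 0)" for k l
        using assms(12) by (auto simp: p_def p1_def p2_def axis_def)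
      \<comment> \<open>The link responses to \<open>p\<close> and \<open>q\<close> differ only
        between \<open>i\<close> and \<open>j\<close>, where \<open>\<sigma>\<close> vanishes. So
        only the new subsidy on existing link strength costs extra.\<close>
      then have "R p k l = R q k l + (if l = (if k = i then j else i)
          then (if k = i \<or> k = j then g x $ i $ j + g x $ j $ i else 0) else 0)"
        if "k \<noteq> l" for k l
        using that assms(12) \<sigma>0 by (auto simp: R_def \<Gamma>pq \<tau>p q_def q1_def q2_def)
      then have "(\<Sum>l\<in>UNIV - {k}. R p k l) = (\<Sum>l\<in>UNIV - {k}. R q k l)
          + (if k = i \<or> k = j then g x $ i $ j + g x $ j $ i else 0)" for k
        using assms(12) by (simp add: sum.distrib)
      moreover have "(\<Sum>k\<in>UNIV. if k = i \<or> k = j then c else 0) = 2 * c" for c :: real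
      proof -
        have "(\<Sum>k\<in>UNIV. if k = i \<or> k = j then c else 0) = (\<Sum>k\<in>{i, j}. c)"
          by (rule sum.mono_neutral_cong_right) auto
        then show ?thesis
          using assms(12) by simp
      qed
      moreover have "(\<Sum>k\<in>UNIV. fst q $ k * a x $ k) = (\<Sum>k\<in>{i, j}. \<gamma> * a x $ i * a x $ j)"
        by (rule sum.mono_neutral_cong_right) (auto simp: fstq)
      moreover have "fst p = 0"
        by (simp add: p_def p1_def p2_def)
      ultimately have "P' p - P' q = 2 * (g x $ i $ j + g x $ j $ i) - 2 * (\<gamma> * a x $ i * a x $ j)"
        using assms(12) by (simp add: P'_def Apq sum.distrib)
      \<comment> \<open>Scaling by \<open>f i j\<close> allows substituting \<open>gval\<close>; as
        \<open>f i j * \<gamma> = 2 * \<rho>\<close>, the terms in \<open>a x $ i * a x $ j\<close>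
        cancel.\<close>
      then have "f i j * (P' p - P' q)
        = 2 * (f i j * g x $ i $ j + f i j * g x $ j $ i) - 2 * (f i j * \<gamma>) * a x $ i * a x $ j"
        by (simp only:) (simp add: algebra_simps)
      also have "\<dots> = 4 * s i j"
        using fij(1) by (simp add: gval \<gamma>_def algebra_simps)
      finally have "f i j * (P' p - P' q) < 0"
        using assms(13) by simp
      then show ?thesis
        using fij(1) by (simp add: mult_less_0_iff)
    qed

    \<comment> \<open>Contradiction with the planner's first-order conditions\<close>
    obtain W' where W': "(W has_derivative W') (at (a x) within {v. \<forall>k. v $ k \<ge> 0})"
      using assms(6) prof(2)[OF x(2)]
      unfolding objective_def differentiable_on_def differentiable_def by blast
    have "a ` S \<subseteq> {v. \<forall>k. v $ k \<ge> 0}"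
      using prof(2) by blast
    then have "((\<lambda>y. W (a y)) has_derivative (\<lambda>c. W' (A c))) (at x within S)"
      using diff_chain_within[OF dA has_derivative_subset[OF W']] by (simp add: o_def)
    then have dL: "(lagrangian W \<mu> sel has_derivative (\<lambda>c. W' (A c) - \<mu> * P' c)) (at x within S)" for \<mu>
      unfolding lagrangian_def[abs_def] a_def[symmetric]
      by (intro has_derivative_diff has_derivative_mult_right dP) (simp add: a_def)
    obtain \<mu> where "\<mu> > 0"
      and K1: "\<forall>k. \<exists>E. has_subsidy_derivative (lagrangian W \<mu> sel) x (axis k 1, 0) E \<and>
          E \<le> 0 \<and> (fst x $ k > 0 \<longrightarrow> E = 0)"
      and K2: "\<forall>k m. k \<noteq> m \<longrightarrow>
          (\<exists>E. has_subsidy_derivative (lagrangian W \<mu> sel) x (0, axis k (axis m 1)) E \<and>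
             E \<le> 0 \<and> (snd x $ k $ m > 0 \<longrightarrow> E = 0))"
      using assms(11) unfolding budget_strictly_binds_def x_def[symmetric] by (elim conjE exE)
    define L' where "L' = (\<lambda>c. W' (A c) - \<mu> * P' c)"
    have linL': "linear L'"
      using dL has_derivative_linear by (auto simp: L'_def)
    have kkt: "E = L' c" if "has_subsidy_derivative (lagrangian W \<mu> sel) x c E" "c \<in> subsidies" for c E
      using has_subsidy_derivative_unique[OF dL[unfolded S_def] U x(1) that(2,1)] by (simp add: L'_def)
    have "L' p1 \<le> 0" "L' p2 \<le> 0"
      using K2[rule_format, OF assms(12), folded p1_def] K2[rule_format, OF assms(12)[symmetric], folded p2_def]
        kkt[OF _ in1(1)] kkt[OF _ in1(2)] by metis+
    \<comment> \<open>Positivity of both action subsidies is used here: equality makes lowering them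
      as admissible to first order as raising them.\<close>
    moreover have "L' q1 = 0" "L' q2 = 0"
      using K1[rule_format, of i, folded q1_def] K1[rule_format, of j, folded q2_def] assms(16,17) \<beta>\<sigma>(1)
        kkt[OF _ in1(3)] kkt[OF _ in1(4)] by metis+
    ultimately have "L' p \<le> 0" "L' q = 0"
      by (simp_all add: p_def q_def linear_add[OF linL'] linear_cmul[OF linL'])
    \<comment> \<open>The welfare terms cancel because \<open>A p = A q\<close>, leaving only the
      payments.\<close>
    then have "\<mu> * (P' p - P' q) \<ge> 0"
      by (simp add: L'_def Apq algebra_simps)
    then show False
      using P'pq \<open>\<mu> > 0\<close> by (simp add: zero_le_mult_iff)
  qed
qed

end
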